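(* Let $E$ be a Banach lattice and let $S,T:E\to E$ be positive operators such that $0\le S\le T\le Id_E$, where $Id_E$ denotes the identity operator of $E$. If $T$ is a uo-demi Dunford–Pettis operator, then $S$ is also a uo-demi Dunford–Pettis operator.
   Context: All Banach lattices are real; "operator" means bounded linear map. A linear map $T$ is positive if $T(x)\ge0$ whenever $x\ge0$, and $S\le T$ means that $T-S$ is positive. A net $(x_\alpha)$ in a Banach lattice $E$ is uo-convergent (unbounded order convergent) to $x$ if $|x_\alpha-x|\wedge y$ converges in order to $0$ for every $y\in E^+$. An operator $T:E\to E$ on a Banach lattice $E$ is uo-demi Dunford–Pettis (unbounded order demi Dunford–Pettis) if for every weakly null sequence $(x_n)$ in $E$ such that $(x_n-T(x_n))$ is uo-convergent to $0$, one has $\|x_n\|\to0$. *)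

theory Defs
  imports "HOL-Analysis.Analysis" "HOL-Library.Lattice_Algebras"
begin

class banach_lattice = banach + ordered_real_vector + lattice_ab_group_add_abs +
  assumes norm_lattice_mono: "\<bar>x\<bar> \<le> \<bar>y\<bar> \<Longrightarrow> norm x \<le> norm y"

definition positive_map :: "('a::banach_lattice \<Rightarrow> 'b::banach_lattice) \<Rightarrow> bool"
  where "positive_map T \<longleftrightarrow> linear T \<and> (\<forall>x\<ge>0. 0 \<le> T x)"

text \<open>The operator order. It differs from the pointwise order \<open>S \<le> T\<close> of functions,
  which compares \<open>S x\<close> and \<open>T x\<close> for all \<open>x\<close> and not only for \<open>x \<ge> 0\<close>.\<close>

definition operator_le :: "('a::banach_lattice \<Rightarrow> 'b::banach_lattice) \<Rightarrow> ('a \<Rightarrow> 'b) \<Rightarrow> bool"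
  where "operator_le S T \<longleftrightarrow> positive_map (\<lambda>x. T x - S x)"

text \<open>A nonempty downward directed set with greatest lower bound \<open>0\<close>. These sets are exactly the
  ranges of the nets that decrease to \<open>0\<close> (a set \<open>D\<close> of this kind, indexed by itself with the
  reversed order, is such a net), so they express quantification over decreasing nets with
  arbitrary index sets.\<close>

definition decreases_to_zero :: "'a::banach_lattice set \<Rightarrow> bool"
  where "decreases_to_zero D \<longleftrightarrow>
    D \<noteq> {} \<and>
    (\<forall>a\<in>D. \<forall>b\<in>D. \<exists>c\<in>D. c \<le> a \<and> c \<le> b) \<and>
    (\<forall>d\<in>D. 0 \<le> d) \<and> (\<forall>z. (\<forall>d\<in>D. z \<le> d) \<longrightarrow> z \<le> 0)"

text \<open>Order convergence of a net \<open>X\<close>, whose index set is represented by its filter \<open>F\<close> of tails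
  (\<open>sequentially\<close> for a sequence): some net \<open>y\<close> decreasing to \<open>0\<close>, possibly with another index
  set, has the property that for every \<open>\<beta>\<close>, \<open>\<bar>X \<alpha> - x\<bar> \<le> y \<beta>\<close> for all sufficiently large
  \<open>\<alpha>\<close>.\<close>

definition order_converges :: "('i \<Rightarrow> 'a::banach_lattice) \<Rightarrow> 'a \<Rightarrow> 'i filter \<Rightarrow> bool"
  where "order_converges X x F \<longleftrightarrow>
    (\<exists>D. decreases_to_zero D \<and> (\<forall>d\<in>D. \<forall>\<^sub>F \<alpha> in F. \<bar>X \<alpha> - x\<bar> \<le> d))"

definition uo_converges :: "('i \<Rightarrow> 'a::banach_lattice) \<Rightarrow> 'a \<Rightarrow> 'i filter \<Rightarrow> bool"
  where "uo_converges X x F \<longleftrightarrow>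
    (\<forall>y\<ge>0. order_converges (\<lambda>\<alpha>. inf \<bar>X \<alpha> - x\<bar> y) 0 F)"

definition weakly_null :: "(nat \<Rightarrow> 'a::real_normed_vector) \<Rightarrow> bool"
  where "weakly_null X \<longleftrightarrow>
    (\<forall>f :: 'a \<Rightarrow> real. bounded_linear f \<longrightarrow> (\<lambda>n. f (X n)) \<longlonglongrightarrow> 0)"

definition uo_demi_dunford_pettis :: "('a::banach_lattice \<Rightarrow> 'a) \<Rightarrow> bool"
  where "uo_demi_dunford_pettis T \<longleftrightarrow>
    bounded_linear T \<and>
    (\<forall>X :: nat \<Rightarrow> 'a. weakly_null X \<longrightarrow> uo_converges (\<lambda>n. X n - T (X n)) 0 sequentially
      \<longrightarrow> (\<lambda>n. norm (X n)) \<longlonglongrightarrow> 0)"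

end

theory Submission
  imports Defs
begin

text \<open>An operator \<open>R\<close> with \<open>0 \<le> R \<le> Id\<close> preserves disjointness, so \<open>\<bar>R x\<bar> = R \<bar>x\<bar>\<close>. Applied to
  \<open>0 \<le> Id - T \<le> Id - S \<le> Id\<close>, this gives \<open>\<bar>x - T x\<bar> \<le> \<bar>x - S x\<bar>\<close>, so that uo-convergence of
  \<open>x\<^sub>n - S x\<^sub>n\<close> to \<open>0\<close> implies that of \<open>x\<^sub>n - T x\<^sub>n\<close>.\<close>

text \<open>As \<open>a + b = inf a b + sup a b\<close>, disjointness turns the sum into
  \<open>sup a b\<close>, so it suffices that the modulus of the difference dominates
  \<open>a\<close> and \<open>b\<close> separately. The converse is the triangle inequality.\<close>

lemma abs_diff_disjoint:
  fixes a b :: "'a::lattice_ab_group_add_abs"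
  assumes "inf a b = 0"
  shows "\<bar>a - b\<bar> = a + b"
proof (rule antisym)
  have pos: "0 \<le> a" "0 \<le> b"
    using assms by (metis inf.cobounded1, metis inf.cobounded2)
  have ge: "u \<le> \<bar>u - v\<bar>" if "inf u v = 0" "0 \<le> v" for u v :: 'a
  proof -
    \<comment> \<open>This makes \<open>u - \<bar>u - v\<bar>\<close> a lower bound of both
      \<open>u\<close> and \<open>v\<close>, hence at most \<open>inf u v = 0\<close>.\<close>
    have "u - \<bar>u - v\<bar> \<le> v"
      using abs_ge_self[of "u - v"] by (simp add: algebra_simps)
    then have "u - \<bar>u - v\<bar> \<le> inf u v" by simp
    with that show ?thesis by simp
  qed
  have "a + b = sup a b" using add_eq_inf_sup[of a b] assms by simp
  also have "\<dots> \<le> \<bar>a - b\<bar>"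
    using ge[of a b] ge[of b a] assms pos by (simp add: inf.commute abs_minus_commute)
  finally show "a + b \<le> \<bar>a - b\<bar>" .
  show "\<bar>a - b\<bar> \<le> a + b"
    using abs_triangle_ineq4[of a b] pos by simp
qed

text \<open>Infima are translation invariant: shifting \<open>x\<close> and \<open>0\<close> by
  \<open>- nprt x\<close> shifts their infimum, which is \<open>nprt x\<close>, to
  \<open>0\<close>.\<close>

lemma inf_pprt_nprt:
  fixes x :: "'a::lattice_ab_group_add"
  shows "inf (pprt x) (- nprt x) = 0"
proof -
  have "inf (pprt x) (- nprt x) = inf (x - nprt x) (0 - nprt x)"
    using prts[of x] by (metis add_diff_cancel_right' diff_0)
  also have "\<dots> = inf x 0 - nprt x"
    by (simp only: diff_conv_add_uminus add_inf_distrib_right)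
  finally show ?thesis by (simp add: nprt_def)
qed

lemma abs_commutes_below_id:
  fixes R :: "'a::banach_lattice \<Rightarrow> 'a"
  assumes "positive_map R" "operator_le R id"
  shows "\<bar>R x\<bar> = R \<bar>x\<bar>"
proof -
  have lin: "linear R" and pos: "\<And>u. 0 \<le> u \<Longrightarrow> 0 \<le> R u"
    and le: "\<And>u. 0 \<le> u \<Longrightarrow> R u \<le> u"
    using assms by (auto simp: positive_map_def operator_le_def)
  \<comment> \<open>\<open>nprt x\<close> is \<open>inf x 0\<close>, so the sign change makes
    \<open>n\<close> the usual positive element with \<open>x = p - n\<close>.\<close>
  define p n where "p = pprt x" and "n = - nprt x"
  have pn: "0 \<le> p" "0 \<le> n" by (simp_all add: p_def n_def)
  have x: "x = p - n" using prts[of x] by (simp add: p_def n_def)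
  have ax: "\<bar>x\<bar> = p + n" by (simp add: abs_prts p_def n_def)
  \<comment> \<open>Domination by the identity enters here: it keeps the images of the disjoint
    \<open>p\<close> and \<open>n\<close> disjoint.\<close>
  have "inf (R p) (R n) \<le> inf p n" using le pn by (meson inf_mono)
  then have "inf (R p) (R n) = 0"
    using pos pn inf_pprt_nprt[of x] by (intro antisym) (simp_all add: p_def n_def)
  from abs_diff_disjoint[OF this] show ?thesis
    using lin unfolding ax by (simp add: x linear_diff linear_add)
qed

text \<open>\<open>Q\<close> also lies below the identity, so both moduli move inside and the
  operators are compared at \<open>\<bar>x\<bar> \<ge> 0\<close>, where their order applies.\<close>

lemma abs_mono_below_id:
  fixes Q R :: "'a::banach_lattice \<Rightarrow> 'a"
  assumes "positive_map Q" "positive_map R" "operator_le Q R" "operator_le R id"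
  shows "\<bar>Q x\<bar> \<le> \<bar>R x\<bar>"
proof -
  have QR: "Q u \<le> R u" and RI: "R u \<le> u" if "0 \<le> u" for u
    using assms that by (auto simp: operator_le_def positive_map_def)
  have "linear Q" using assms(1) by (simp add: positive_map_def)
  then have "linear (\<lambda>u. id u - Q u)"
    by (rule linear_compose_sub[OF linear_id])
  then have "operator_le Q id"
    using order_trans[OF QR RI] by (auto simp: operator_le_def positive_map_def)
  then have "\<bar>Q x\<bar> = Q \<bar>x\<bar>" by (rule abs_commutes_below_id[OF assms(1)])
  also have "\<dots> \<le> R \<bar>x\<bar>" by (simp add: QR)
  also have "\<dots> = \<bar>R x\<bar>" by (rule abs_commutes_below_id[OF assms(2,4), symmetric])
  finally show ?thesis .
qed

lemma order_converges_zero_mono: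
  fixes X Y :: "'i \<Rightarrow> 'a::banach_lattice"
  assumes "order_converges Y 0 F" "\<And>i. \<bar>X i\<bar> \<le> \<bar>Y i\<bar>"
  shows "order_converges X 0 F"
proof -
  obtain D where "decreases_to_zero D" and D: "\<And>d. d \<in> D \<Longrightarrow> \<forall>\<^sub>F i in F. \<bar>Y i - 0\<bar> \<le> d"
    using assms(1) by (auto simp: order_converges_def)
  moreover have "\<forall>\<^sub>F i in F. \<bar>X i - 0\<bar> \<le> d" if "d \<in> D" for d
    using D[OF that] by eventually_elim (use assms(2) order_trans in auto)
  ultimately show ?thesis by (auto simp: order_converges_def)
qed

lemma uo_converges_zero_mono:
  fixes X Y :: "'i \<Rightarrow> 'a::banach_lattice"
  assumes "uo_converges Y 0 F" "\<And>i. \<bar>X i\<bar> \<le> \<bar>Y i\<bar>"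
  shows "uo_converges X 0 F"
  unfolding uo_converges_def
proof (intro allI impI)
  fix y :: 'a assume y: "0 \<le> y"
  then have "order_converges (\<lambda>i. inf \<bar>Y i - 0\<bar> y) 0 F"
    using assms(1) by (simp add: uo_converges_def)
  then show "order_converges (\<lambda>i. inf \<bar>X i - 0\<bar> y) 0 F"
    \<comment> \<open>Truncation by \<open>y\<close> preserves domination, and the truncated terms,
      being nonnegative, equal their moduli.\<close>
    by (rule order_converges_zero_mono) (use y assms(2) in \<open>simp add: abs_of_nonneg le_infI1\<close>)
qed

theorem proposition6p1:
  fixes S T :: "'a::banach_lattice \<Rightarrow> 'a"
  assumes "bounded_linear S" and "bounded_linear T"
    and "positive_map S" and "positive_map T"
    and "operator_le S T" and "operator_le T id"
    and "uo_demi_dunford_pettis T"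
  shows "uo_demi_dunford_pettis S"
proof -
  have linS: "linear S" and linT: "linear T"
    using assms(3,4) by (auto simp: positive_map_def)
  have ST: "S u \<le> T u" and TI: "T u \<le> u" if "0 \<le> u" for u
    using assms(5,6) that by (auto simp: operator_le_def positive_map_def)
  have "linear (\<lambda>u. u - S u)"
    using linear_compose_sub[OF linear_id linS] by simp
  then have "positive_map (\<lambda>u. u - S u)"
    using order_trans[OF ST TI] by (auto simp: positive_map_def)
  moreover have "positive_map (\<lambda>u. u - T u)"
    using assms(6) by (simp add: operator_le_def)
  \<comment> \<open>Complements reverse the order: the difference here is \<open>T - S\<close>, and
    in the next step it is \<open>S\<close>.\<close>
  moreover have "operator_le (\<lambda>u. u - T u) (\<lambda>u. u - S u)"
    using assms(5) by (simp add: operator_le_def)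
  moreover have "operator_le (\<lambda>u. u - S u) id"
    using assms(3) by (simp add: operator_le_def)
  ultimately have key: "\<bar>x - T x\<bar> \<le> \<bar>x - S x\<bar>" for x
    by (intro abs_mono_below_id[of "\<lambda>u. u - T u" "\<lambda>u. u - S u"])
  show ?thesis
    unfolding uo_demi_dunford_pettis_def
  proof (intro conjI allI impI assms(1))
    fix X :: "nat \<Rightarrow> 'a"
    assume "weakly_null X" "uo_converges (\<lambda>n. X n - S (X n)) 0 sequentially"
    \<comment> \<open>The same sequence is tested against \<open>T\<close>, so only the
      uo-convergence has to be transferred.\<close>
    moreover from this(2) have "uo_converges (\<lambda>n. X n - T (X n)) 0 sequentially"
      by (rule uo_converges_zero_mono) (rule key)
    ultimately show "(\<lambda>n. norm (X n)) \<longlonglongrightarrow> 0"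
      using assms(7) by (simp add: uo_demi_dunford_pettis_def)
  qed
qed

end
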